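(* Let $X$ be a separable complex Banach space, let $r\ge 1$, and let $T_1,\ldots,T_r$ be bounded linear operators on $X$. Suppose that there exists a (strictly) increasing sequence of positive integers $(n_k)_{k\ge 1}$ and that for every $1\le i\le r$ there exist a sequence $(\lambda^{(i)}_{n_k})_{k\ge1}\subset \mathbb{D}\setminus\{0\}$, dense sets $X_i,Y_i\subset X$, and a map $S_i:Y_i\to X$ whose iterates $S_i^{n_k}$ are defined on $Y_i$ (that is, $S_i(Y_i)\subseteq Y_i$), such that for all $x_i\in X_i$ and $y_i\in Y_i$ $(1\le i\le r)$, as $k\to\infty$: 1. $\bigl(\lambda^{(1)}_{n_k}T_1^{n_k}x_1,\ldots,\lambda^{(r)}_{n_k}T_r^{n_k}x_r\bigr)\to(0,\ldots,0)$; 2. $\Bigl(\frac{1}{\lambda^{(1)}_{n_k}}S_1^{n_k}y_1,\ldots,\frac{1}{\lambda^{(r)}_{n_k}}S_r^{n_k}y_r\Bigr)\to(0,\ldots,0)$; 3. $\bigl(T_1^{n_k}S_1^{n_k}y_1,\ldots,T_r^{n_k}S_r^{n_k}y_r\bigr)\to(y_1,\ldots,y_r)$. Then $T_1\oplus\cdots\oplus T_r$ is $r$-bitransitive.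
   Context: $\mathbb{D}=\{z\in\mathbb{C}:|z|\le 1\}$ is the closed unit disk. $S_i$ is not assumed linear or continuous; $S_i^{n}$ denotes its $n$-fold composition. $\bigoplus_{i=1}^r X$ is the $r$-fold direct sum of $X$ (with any of the usual equivalent norms, e.g. the sum norm), and $T_1\oplus\cdots\oplus T_r$ acts on it by $(x_1,\ldots,x_r)\mapsto(T_1x_1,\ldots,T_rx_r)$. For sets $A_i\subset X$, $A_1\oplus\cdots\oplus A_r=\{(a_1,\ldots,a_r):a_i\in A_i\}$. Definition ($k$-bitransitive): an operator $T$ on $\bigoplus_{i=1}^k X$ is $k$-bitransitive if there exist bounded linear operators $T_1,\ldots,T_k$ on $X$ with $T=T_1\oplus\cdots\oplus T_k$ such that for all nonempty open sets $U_1,\ldots,U_k,V_1,\ldots,V_k\subset X$ there exist a positive integer $n$ and $\alpha_1,\ldots,\alpha_k\in\mathbb{D}\setminus\{0\}$ with $(T_1\oplus\cdots\oplus T_k)^n(\alpha_1U_1\oplus\cdots\oplus\alpha_kU_k)\cap(V_1\oplus\cdots\oplus V_k)\neq\emptyset$. *)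

theory Defs
  imports "HOL-Analysis.Analysis"
begin

(* Complex normed spaces are real normed spaces with a complex scalar multiplication extending
   the given real one (scaleR_scaleC).  The unit law and the completeness notion are
   inherited from the real structure. *)

class complex_normed_vector = real_normed_vector +
  fixes scaleC :: "complex \<Rightarrow> 'a \<Rightarrow> 'a"  (infixr \<open>*\<^sub>C\<close> 75)
  assumes scaleC_add_right: "a *\<^sub>C (x + y) = a *\<^sub>C x + a *\<^sub>C y"
    and scaleC_add_left: "(a + b) *\<^sub>C x = a *\<^sub>C x + b *\<^sub>C x"
    and scaleC_scaleC: "a *\<^sub>C b *\<^sub>C x = (a * b) *\<^sub>C x"
    and scaleR_scaleC: "r *\<^sub>R x = complex_of_real r *\<^sub>C x"
    and norm_scaleC: "norm (a *\<^sub>C x) = cmod a * norm x"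

class complex_banach = complex_normed_vector + banach

instantiation complex :: complex_banach
begin

definition scaleC_complex :: "complex \<Rightarrow> complex \<Rightarrow> complex" where
  "scaleC_complex a x = a * x"

instance
  by standard (simp_all add: scaleC_complex_def algebra_simps norm_mult scaleR_conv_of_real)

end

definition bounded_clinear ::
    "('a::complex_normed_vector \<Rightarrow> 'b::complex_normed_vector) \<Rightarrow> bool" where
  "bounded_clinear f \<longleftrightarrow> bounded_linear f \<and> (\<forall>c x. f (c *\<^sub>C x) = c *\<^sub>C f x)"

(* The k-fold direct sum of X is the type 'a ^ 'k with k = CARD('k), which is at least 1.
   Its library norm is the l2 norm of the tuple of component norms. *)

instantiation vec :: (complex_normed_vector, finite) complex_normed_vector
begin

definition scaleC_vec :: "complex \<Rightarrow> 'a ^ 'b \<Rightarrow> 'a ^ 'b" where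
  "scaleC_vec c x = (\<chi> i. c *\<^sub>C (x $ i))"

instance
proof
  fix a b :: complex and r :: real and x y :: "'a ^ 'b"
  show "a *\<^sub>C (x + y) = a *\<^sub>C x + a *\<^sub>C y"
    by (simp add: scaleC_vec_def vec_eq_iff scaleC_add_right)
  show "(a + b) *\<^sub>C x = a *\<^sub>C x + b *\<^sub>C x"
    by (simp add: scaleC_vec_def vec_eq_iff scaleC_add_left)
  show "a *\<^sub>C b *\<^sub>C x = (a * b) *\<^sub>C x"
    by (simp add: scaleC_vec_def vec_eq_iff scaleC_scaleC)
  show "r *\<^sub>R x = complex_of_real r *\<^sub>C x"
    by (simp add: scaleC_vec_def vec_eq_iff scaleR_scaleC)
  show "norm (a *\<^sub>C x) = cmod a * norm x"
    by (simp add: scaleC_vec_def norm_vec_def norm_scaleC L2_set_right_distrib)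
qed

end

instance vec :: (complex_banach, finite) complex_banach ..

definition direct_sum_op :: "('k \<Rightarrow> 'a \<Rightarrow> 'a) \<Rightarrow> 'a ^ 'k \<Rightarrow> 'a ^ 'k" where
  "direct_sum_op T x = (\<chi> i. T i (x $ i))"

definition direct_sum_set :: "('k \<Rightarrow> 'a set) \<Rightarrow> ('a ^ 'k) set" where
  "direct_sum_set A = {x. \<forall>i. x $ i \<in> A i}"

(* k-bitransitivity of an operator on the k-fold direct sum, k = CARD('k); cball 0 1 is the
   closed unit disk of the complex plane. *)

definition bitransitive :: "('a::complex_banach ^ 'k::finite \<Rightarrow> 'a ^ 'k) \<Rightarrow> bool" where
  "bitransitive T \<longleftrightarrow>
     (\<exists>S :: 'k \<Rightarrow> 'a \<Rightarrow> 'a.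
        (\<forall>i. bounded_clinear (S i)) \<and> T = direct_sum_op S \<and>
        (\<forall>U V :: 'k \<Rightarrow> 'a set.
           (\<forall>i. open (U i) \<and> U i \<noteq> {} \<and> open (V i) \<and> V i \<noteq> {}) \<longrightarrow>
           (\<exists>n > 0. \<exists>\<alpha> :: 'k \<Rightarrow> complex.
              (\<forall>i. \<alpha> i \<in> cball 0 1 - {0}) \<and>
              (direct_sum_op S ^^ n) ` direct_sum_set (\<lambda>i. (\<lambda>x. \<alpha> i *\<^sub>C x) ` U i)
                \<inter> direct_sum_set V \<noteq> {})))"

end

theory Submission
  imports Defs
begin

(* Pick x_i in U_i and X_i, and y_i in V_i and Y_i. With N = n_k, perturb x_i to
   x_i + S_i^N y_i / lambda_i, which tends to x_i by (2); applying lambda_i T_i^N yields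
   lambda_i T_i^N x_i + T_i^N S_i^N y_i, which tends to y_i by (1) and (3). So for large k the
   scalars alpha_i = lambda_i witness bitransitivity. *)

lemma bounded_clinear_funpow:
  fixes f :: "'a::complex_normed_vector \<Rightarrow> 'a"
  assumes "bounded_clinear f"
  shows "bounded_clinear (f ^^ m)"
proof (induction m)
  case 0
  have "f ^^ 0 = (\<lambda>x. x)" by (simp add: fun_eq_iff)
  then show ?case by (simp add: bounded_clinear_def bounded_linear_ident del: funpow.simps)
next
  case (Suc m)
  with assms show ?case
    by (simp add: bounded_clinear_def o_def bounded_linear_compose)
qed

text \<open>The coordinates of a direct sum never interact, so whether a power lands in a product of
  sets can be tested one index at a time.\<close>

lemma direct_sum_op_funpow_nth:
  "(direct_sum_op T ^^ m) x $ i = (T i ^^ m) (x $ i)"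
  by (induction m) (simp_all add: direct_sum_op_def)

lemma dense_meets_open:
  fixes A B :: "'a::topological_space set"
  assumes "closure A = UNIV" "open B" "B \<noteq> {}"
  shows "\<exists>x. x \<in> A \<inter> B"
  using open_Int_closure_eq_empty[OF assms(2), of A] assms by auto

theorem theorem2p6:
  fixes T :: "'r::finite \<Rightarrow> 'a::complex_banach \<Rightarrow> 'a"
    and n :: "nat \<Rightarrow> nat"
    and lam :: "'r \<Rightarrow> nat \<Rightarrow> complex"
    and X Y :: "'r \<Rightarrow> 'a set"
    and S :: "'r \<Rightarrow> 'a \<Rightarrow> 'a"
  assumes "separable_space (euclidean :: 'a topology)"
    and "\<And>i. bounded_clinear (T i)"
    and "strict_mono n" and "\<And>k. n k > 0"
    and "\<And>i k. lam i (n k) \<in> cball 0 1 - {0}"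
    and "\<And>i. closure (X i) = UNIV" and "\<And>i. closure (Y i) = UNIV"
    and "\<And>i. S i ` Y i \<subseteq> Y i"
    and "\<And>x. x \<in> direct_sum_set X \<Longrightarrow>
           (\<lambda>k. \<chi> i. lam i (n k) *\<^sub>C (T i ^^ n k) (x $ i)) \<longlonglongrightarrow> 0"
    and "\<And>y. y \<in> direct_sum_set Y \<Longrightarrow>
           (\<lambda>k. \<chi> i. (1 / lam i (n k)) *\<^sub>C (S i ^^ n k) (y $ i)) \<longlonglongrightarrow> 0"
    and "\<And>y. y \<in> direct_sum_set Y \<Longrightarrow>
           (\<lambda>k. \<chi> i. (T i ^^ n k) ((S i ^^ n k) (y $ i))) \<longlonglongrightarrow> y"
  shows "bitransitive (direct_sum_op T)"
proof -
  have "\<exists>m > 0. \<exists>\<alpha> :: 'r \<Rightarrow> complex. (\<forall>i. \<alpha> i \<in> cball 0 1 - {0}) \<and>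
          (direct_sum_op T ^^ m) ` direct_sum_set (\<lambda>i. (\<lambda>x. \<alpha> i *\<^sub>C x) ` U i)
            \<inter> direct_sum_set V \<noteq> {}"
    if UV: "\<forall>i. open (U i) \<and> U i \<noteq> {} \<and> open (V i) \<and> V i \<noteq> {}" for U V
  proof -
    have "\<forall>i. \<exists>x. x \<in> X i \<inter> U i" "\<forall>i. \<exists>y. y \<in> Y i \<inter> V i"
      using UV by (blast intro!: dense_meets_open assms(6,7))+
    then obtain x' y' where x': "\<And>i. x' i \<in> X i \<inter> U i" and y': "\<And>i. y' i \<in> Y i \<inter> V i"
      by metis
    \<comment> \<open>The limit hypotheses concern tuples in the direct sum, so the chosen points
      are bundled into vectors; each limit is then read off coordinatewise.\<close>
    define x where "x = (\<chi> i. x' i)"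
    define y where "y = (\<chi> i. y' i)"
    have x: "x \<in> direct_sum_set X" "\<And>i. x $ i \<in> U i"
      and y: "y \<in> direct_sum_set Y" "\<And>i. y $ i \<in> V i"
      using x' y' by (auto simp: direct_sum_set_def x_def y_def)
    define u where
      "u k i = x $ i + (1 / lam i (n k)) *\<^sub>C (S i ^^ n k) (y $ i)" for k i
    \<comment> \<open>\<open>v k i\<close> is the expected image of
      \<open>lam i (n k) *\<^sub>C u k i\<close> under \<open>T i ^^ n k\<close>, written already
      split so that its limit follows term by term.\<close>
    define v where
      "v k i = lam i (n k) *\<^sub>C (T i ^^ n k) (x $ i) + (T i ^^ n k) ((S i ^^ n k) (y $ i))" for k i
    have "(\<lambda>k. u k i) \<longlonglongrightarrow> x $ i" for i
      unfolding u_def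
      using tendsto_add[OF tendsto_const tendsto_vec_nth[OF assms(10)[OF y(1)], of i]]
      by simp
    moreover have "(\<lambda>k. v k i) \<longlonglongrightarrow> y $ i" for i
      unfolding v_def
      using tendsto_add[OF tendsto_vec_nth[OF assms(9)[OF x(1)], of i]
          tendsto_vec_nth[OF assms(11)[OF y(1)], of i]]
      by simp
    ultimately have "\<forall>\<^sub>F k in sequentially. u k i \<in> U i \<and> v k i \<in> V i" for i
      using UV x(2)[of i] y(2)[of i]
      by (intro eventually_conj) (metis topological_tendstoD)+
    \<comment> \<open>As the index type is finite, the thresholds for the separate indices have a
      common bound, so one \<open>k\<close> serves all coordinates.\<close>
    then have "\<forall>\<^sub>F k in sequentially. \<forall>i. u k i \<in> U i \<and> v k i \<in> V i"
      by (simp add: eventually_all_finite)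
    then obtain k where k: "\<And>i. u k i \<in> U i" "\<And>i. v k i \<in> V i"
      by (auto simp: eventually_sequentially)
    define z where "z = (\<chi> i. lam i (n k) *\<^sub>C u k i)"
    have "(T i ^^ n k) (z $ i) = v k i" for i
    proof -
      have "lam i (n k) \<noteq> 0" using assms(5)[of i k] by simp
      \<comment> \<open>In the second summand the scalar cancels against its inverse. The remaining
        factor 1 disappears because complex scaling by 1 agrees with real scaling by 1.\<close>
      then have z: "z $ i = lam i (n k) *\<^sub>C (x $ i) + (S i ^^ n k) (y $ i)"
        using scaleR_scaleC[of 1 "(S i ^^ n k) (y $ i)"]
        by (simp add: z_def u_def scaleC_add_right scaleC_scaleC)
      \<comment> \<open>Additivity of the power splits the image of \<open>z $ i\<close>, and
        complex homogeneity moves \<open>lam i (n k)\<close> out of the first term, giving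
        \<open>v k i\<close>.\<close>
      have "bounded_clinear (T i ^^ n k)"
        using assms(2) by (rule bounded_clinear_funpow)
      then show ?thesis
        by (simp add: z v_def bounded_clinear_def bounded_linear.linear linear_add)
    qed
    then have "(direct_sum_op T ^^ n k) z \<in> direct_sum_set V"
      using k(2) by (simp add: direct_sum_set_def direct_sum_op_funpow_nth)
    moreover have "z \<in> direct_sum_set (\<lambda>i. (\<lambda>x. lam i (n k) *\<^sub>C x) ` U i)"
      using k(1) by (simp add: direct_sum_set_def z_def)
    ultimately show ?thesis
      using assms(4)[of k] assms(5)
      by (intro exI[of _ "n k"] conjI exI[of _ "\<lambda>i. lam i (n k)"]) blast+
  qed
  \<comment> \<open>The family \<open>T\<close> itself is the witness for the decomposition into
    bounded operators.\<close>
  with assms(2) show ?thesis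
    unfolding bitransitive_def by blast
qed

end
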